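(* Let $w\in\mathbb R^n$ be a unit vector, $x_0$ a point, and let $\mathcal S_p,\mathcal S_m$ be simplices as in the context. Then the finite difference schemes $\mathcal D_wu(x_0)$, $\mathcal D_{-w}u(x_0)$ and $\mathcal D_{ww}u(x_0)$ defined in the context are monotone and stable.
   Context: Let $\mathcal S_p$ and $\mathcal S_m$ be sets of $n$ points in $\mathbb R^n$, each the vertex set of an $(n-1)$-dimensional simplex, such that the matrices $V_p$, $V_m$ with columns $x_i-x_0$ ($x_i\in\mathcal S_p$, respectively $x_i\in\mathcal S_m$) are invertible, and such that for some $t_p,t_m>0$ the point $x_0+t_pw$ lies in the convex hull of $\mathcal S_p$ and $x_0-t_mw$ lies in the convex hull of $\mathcal S_m$. Then $t_p=\frac1{\mathbf 1^{\mathsf T}V_p^{-1}w}$ and $t_m=\frac{-1}{\mathbf 1^{\mathsf T}V_m^{-1}w}$, where $\mathbf 1$ is the all-ones vector. Linear interpolants: $L_p(x)=\sum_{i\in\mathcal S_p}\lambda_p^i(x)u(x_i)$, where for $x$ in the simplex $\lambda_p(x)$ is the vector of barycentric coordinates, solving $V_p\lambda_p=x-x_0$; $L_m,\lambda_m$ are defined in the same way using $\mathcal S_m,V_m$. Schemes: $$\mathcal D_wu(x_0)=\frac{L_p(x_0+t_pw)-u(x_0)}{t_p},\qquad \mathcal D_{-w}u(x_0)=\frac{L_m(x_0-t_mw)-u(x_0)}{t_m},$$ $$\mathcal D_{ww}u(x_0)=\frac{2\left(\mathcal D_wu(x_0)+\mathcal D_{-w}u(x_0)\right)}{t_p+t_m}.$$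 A linear scheme $\mathcal Du(x_0)$ is monotone if it can be written $\mathcal Du(x_0)=\sum_i a_i\,(u(x_i)-u(x_0))$ with the sum over stencil points $x_i\ne x_0$ and all coefficients $a_i\ge0$. It is stable if, for all sufficiently small $\rho>0$, the explicit Euler update $u\mapsto u(x_0)+\rho\,\mathcal Du(x_0)$ is non-expansive in the maximum norm: for all grid functions $u,v$, $$\left|u(x_0)+\rho\mathcal Du(x_0)-v(x_0)-\rho\mathcal Dv(x_0)\right|\le\max_{x}|u(x)-v(x)|,$$ the maximum being over $x_0$ and the stencil points. *)

theory Defs
  imports "HOL-Analysis.Analysis"
begin

text \<open>
  A simplex vertex set with \<open>n = CARD('n)\<close> points is given by an enumeration
  \<open>p :: 'n \<Rightarrow> real ^ 'n\<close>; the set itself is \<open>range p\<close>.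
\<close>

definition edge_matrix :: "real ^ 'n \<Rightarrow> ('n \<Rightarrow> real ^ 'n) \<Rightarrow> real ^ 'n ^ 'n"
  where "edge_matrix x0 p = (\<chi> k i. (p i - x0) $ k)"

definition bary_coords :: "real ^ 'n \<Rightarrow> ('n \<Rightarrow> real ^ 'n) \<Rightarrow> real ^ 'n \<Rightarrow> real ^ 'n"
  where "bary_coords x0 p x = (THE l. edge_matrix x0 p *v l = x - x0)"

text \<open>
  The vector \<open>bary_coords x0 p x\<close> is defined for every \<open>x\<close> when the edge matrix is invertible.
  On the affine hull of the vertices it is the usual vector of barycentric coordinates:
\<close>

lemma bary_coords_eqI:
  fixes x0 x l :: "real ^ 'n" and p :: "'n \<Rightarrow> real ^ 'n"
  assumes inv: "invertible (edge_matrix x0 p)"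
    and sum1: "(\<Sum>i\<in>UNIV. l $ i) = 1" and comb: "(\<Sum>i\<in>UNIV. l $ i *\<^sub>R p i) = x"
  shows "bary_coords x0 p x = l"
  unfolding bary_coords_def
proof (rule the_equality)
  have "edge_matrix x0 p *v l = (\<Sum>i\<in>UNIV. l $ i *\<^sub>R (p i - x0))"
    by (simp add: vec_eq_iff edge_matrix_def matrix_vector_mult_def mult.commute)
  also have "\<dots> = x - x0"
    by (simp add: scaleR_diff_right sum_subtractf comb sum1 flip: scaleR_left.sum)
  finally show eq: "edge_matrix x0 p *v l = x - x0" .
  show "l' = l" if "edge_matrix x0 p *v l' = x - x0" for l'
    using inv eq that by (metis inj_matrix_vector_mult injD)
qed

definition lin_interp ::
    "real ^ 'n \<Rightarrow> ('n \<Rightarrow> real ^ 'n) \<Rightarrow> (real ^ 'n \<Rightarrow> real) \<Rightarrow> real ^ 'n \<Rightarrow> real"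
  where "lin_interp x0 p u x = (\<Sum>i\<in>UNIV. bary_coords x0 p x $ i * u (p i))"

definition D_plus ::
    "real ^ 'n \<Rightarrow> ('n \<Rightarrow> real ^ 'n) \<Rightarrow> real \<Rightarrow> real ^ 'n \<Rightarrow> (real ^ 'n \<Rightarrow> real) \<Rightarrow> real"
  where "D_plus x0 p tp w u = (lin_interp x0 p u (x0 + tp *\<^sub>R w) - u x0) / tp"

definition D_minus ::
    "real ^ 'n \<Rightarrow> ('n \<Rightarrow> real ^ 'n) \<Rightarrow> real \<Rightarrow> real ^ 'n \<Rightarrow> (real ^ 'n \<Rightarrow> real) \<Rightarrow> real"
  where "D_minus x0 m tm w u = (lin_interp x0 m u (x0 - tm *\<^sub>R w) - u x0) / tm"

definition D_second ::
    "real ^ 'n \<Rightarrow> ('n \<Rightarrow> real ^ 'n) \<Rightarrow> ('n \<Rightarrow> real ^ 'n) \<Rightarrow> real \<Rightarrow> real \<Rightarrow> real ^ 'n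
      \<Rightarrow> (real ^ 'n \<Rightarrow> real) \<Rightarrow> real"
  where "D_second x0 p m tp tm w u =
    2 * (D_plus x0 p tp w u + D_minus x0 m tm w u) / (tp + tm)"

text \<open>
  A scheme at \<open>x0\<close> with finite stencil \<open>N\<close> is a functional \<open>D\<close>, with \<open>D u\<close> standing for the
  value of the scheme on \<open>u\<close> at \<open>x0\<close>. Grid functions are represented by total functions. The
  representation demanded below makes \<open>D\<close> linear, with coefficients independent of \<open>u\<close>.
\<close>

definition monotone_scheme :: "'a \<Rightarrow> 'a set \<Rightarrow> (('a \<Rightarrow> real) \<Rightarrow> real) \<Rightarrow> bool"
  where "monotone_scheme x0 N D \<longleftrightarrow>
    (\<exists>a. (\<forall>y\<in>N - {x0}. a y \<ge> 0) \<and> (\<forall>u. D u = (\<Sum>y\<in>N - {x0}. a y * (u y - u x0))))"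

definition stable_scheme :: "'a \<Rightarrow> 'a set \<Rightarrow> (('a \<Rightarrow> real) \<Rightarrow> real) \<Rightarrow> bool"
  where "stable_scheme x0 N D \<longleftrightarrow>
    (\<exists>\<rho>0>0. \<forall>\<rho>. 0 < \<rho> \<and> \<rho> < \<rho>0 \<longrightarrow>
      (\<forall>u v. \<bar>(u x0 + \<rho> * D u) - (v x0 + \<rho> * D v)\<bar> \<le> (MAX x\<in>insert x0 N. \<bar>u x - v x\<bar>)))"

end

theory Submission
  imports Defs
begin

text \<open>
  A directional difference quotient has the form \<open>c * ((\<Sum>i. l\<^sub>i u(x\<^sub>i)) - u(x\<^sub>0))\<close> with \<open>c > 0\<close>,
  where \<open>l\<close> is the vector of interpolation weights. The interpolation point lies in the convex
  hull of the stencil, so it is a convex combination of the vertices, and invertibility of the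
  edge matrix makes these convex weights the only solution of the linear system that
  defines \<open>l\<close> (\<open>bary_coords_in_convex_hull\<close>). Because the weights add up to one, the constant
  \<open>u(x\<^sub>0)\<close> can be moved into the sum, which gives
  \<open>\<Sum>i. c l\<^sub>i (u(x\<^sub>i) - u(x\<^sub>0))\<close> with coefficients \<open>c l\<^sub>i \<ge> 0\<close>
  (\<open>monotone_scheme_interpolation\<close>). The second difference is a nonnegative multiple of a sum of
  two such schemes, and monotonicity survives enlarging the stencil, addition and nonnegative
  scaling.

  Stability is a consequence of monotonicity alone (\<open>monotone_imp_stable\<close>): if \<open>A\<close> is the sum of
  the coefficients, an Euler step of length \<open>\<rho>\<close> with \<open>\<rho> A \<le> 1\<close> replaces
  \<open>u(x\<^sub>0)\<close> by a convex combination of the values of \<open>u\<close> at \<open>x\<^sub>0\<close> and at the stencil points.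
\<close>

text \<open>
  The summand at \<open>x0\<close> vanishes, so a representation may range over the whole stencil even if
  \<open>x0\<close> belongs to it.
\<close>

lemma monotone_scheme_iff:
  assumes "finite N"
  shows "monotone_scheme x0 N D \<longleftrightarrow>
    (\<exists>a. (\<forall>y. a y \<ge> 0) \<and> (\<forall>u. D u = (\<Sum>y\<in>N. a y * (u y - u x0))))"
proof
  assume "monotone_scheme x0 N D"
  then obtain a where a: "\<forall>y\<in>N - {x0}. a y \<ge> 0"
      and D: "\<And>u. D u = (\<Sum>y\<in>N - {x0}. a y * (u y - u x0))"
    unfolding monotone_scheme_def by auto
  define b where "b y = (if y \<in> N - {x0} then a y else 0)" for y
  have "\<forall>y. b y \<ge> 0"
    using a by (simp add: b_def)
  moreover have "D u = (\<Sum>y\<in>N. b y * (u y - u x0))" for u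
    unfolding D by (rule sum.mono_neutral_cong_left) (auto simp: b_def assms)
  ultimately show "\<exists>a. (\<forall>y. a y \<ge> 0) \<and> (\<forall>u. D u = (\<Sum>y\<in>N. a y * (u y - u x0)))"
    by blast
next
  assume "\<exists>a. (\<forall>y. a y \<ge> 0) \<and> (\<forall>u. D u = (\<Sum>y\<in>N. a y * (u y - u x0)))"
  then obtain a where a: "\<forall>y. a y \<ge> 0"
      and D: "\<And>u. D u = (\<Sum>y\<in>N. a y * (u y - u x0))"
    by auto
  have "D u = (\<Sum>y\<in>N - {x0}. a y * (u y - u x0))" for u
    unfolding D by (rule sum.mono_neutral_cong_right) (auto simp: assms)
  with a show "monotone_scheme x0 N D"
    unfolding monotone_scheme_def by blast
qed

lemma monotone_scheme_superset:
  assumes "monotone_scheme x0 N D" "N \<subseteq> M" "finite M"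
  shows "monotone_scheme x0 M D"
proof -
  from assms obtain a where a: "\<forall>y\<in>N - {x0}. a y \<ge> 0"
      and D: "\<And>u. D u = (\<Sum>y\<in>N - {x0}. a y * (u y - u x0))"
    unfolding monotone_scheme_def by auto
  define b where "b y = (if y \<in> N - {x0} then a y else 0)" for y
  have "\<forall>y\<in>M - {x0}. b y \<ge> 0"
    using a by (simp add: b_def)
  moreover have "D u = (\<Sum>y\<in>M - {x0}. b y * (u y - u x0))" for u
    unfolding D by (rule sum.mono_neutral_cong_left) (use assms in \<open>auto simp: b_def\<close>)
  ultimately show ?thesis
    unfolding monotone_scheme_def by blast
qed

lemma monotone_scheme_add:
  assumes "monotone_scheme x0 N D" "monotone_scheme x0 N E"
  shows "monotone_scheme x0 N (\<lambda>u. D u + E u)"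
proof -
  from assms obtain a b where a: "\<forall>y\<in>N - {x0}. a y \<ge> 0"
      and D: "\<And>u. D u = (\<Sum>y\<in>N - {x0}. a y * (u y - u x0))"
      and b: "\<forall>y\<in>N - {x0}. b y \<ge> 0"
      and E: "\<And>u. E u = (\<Sum>y\<in>N - {x0}. b y * (u y - u x0))"
    unfolding monotone_scheme_def by auto
  have "D u + E u = (\<Sum>y\<in>N - {x0}. (a y + b y) * (u y - u x0))" for u
    by (simp add: D E distrib_right sum.distrib)
  with a b show ?thesis
    unfolding monotone_scheme_def by (intro exI[of _ "\<lambda>y. a y + b y"]) auto
qed

lemma monotone_scheme_cmult:
  assumes "monotone_scheme x0 N D" "c \<ge> 0"
  shows "monotone_scheme x0 N (\<lambda>u. c * D u)"
proof -
  from assms obtain a where a: "\<forall>y\<in>N - {x0}. a y \<ge> 0"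
      and D: "\<And>u. D u = (\<Sum>y\<in>N - {x0}. a y * (u y - u x0))"
    unfolding monotone_scheme_def by auto
  have "c * D u = (\<Sum>y\<in>N - {x0}. (c * a y) * (u y - u x0))" for u
    by (simp add: D sum_distrib_left mult.assoc)
  with a \<open>c \<ge> 0\<close> show ?thesis
    unfolding monotone_scheme_def by (intro exI[of _ "\<lambda>y. c * a y"]) auto
qed

text \<open>
  Applied to the difference \<open>e = u - v\<close>, one Euler step gives
  \<open>(1 - \<rho> A) e(x\<^sub>0) + \<rho> (\<Sum>y. a\<^sub>y e(y))\<close> with \<open>A = \<Sum>y. a\<^sub>y\<close>. For \<open>\<rho> A \<le> 1\<close> all weights are
  nonnegative and add up to one, so the result is bounded by the maximum of \<open>\<bar>e\<bar>\<close>.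
\<close>

lemma monotone_imp_stable:
  assumes mono: "monotone_scheme x0 N D" and fin: "finite N"
  shows "stable_scheme x0 N D"
proof -
  from mono obtain a where a: "\<And>y. a y \<ge> 0"
      and D: "\<And>u. D u = (\<Sum>y\<in>N. a y * (u y - u x0))"
    unfolding monotone_scheme_iff[OF fin] by auto
  define A where "A = (\<Sum>y\<in>N. a y)"
  have "A \<ge> 0"
    unfolding A_def using a by (simp add: sum_nonneg)
  \<comment> \<open>The bound \<open>1 / (1 + A)\<close> implies \<open>\<rho> A \<le> 1\<close> and stays positive when \<open>A = 0\<close>, where \<open>1 / A\<close> is \<open>0\<close>.\<close>
  have "\<bar>(u x0 + \<rho> * D u) - (v x0 + \<rho> * D v)\<bar> \<le> (MAX x\<in>insert x0 N. \<bar>u x - v x\<bar>)"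
    if \<rho>: "0 < \<rho>" "\<rho> < 1 / (1 + A)" for \<rho> u v
  proof -
    define e where "e y = u y - v y" for y
    define M where "M = (MAX x\<in>insert x0 N. \<bar>u x - v x\<bar>)"
    have e_le: "\<bar>e y\<bar> \<le> M" if "y \<in> insert x0 N" for y
      unfolding M_def e_def using that fin by (intro Max_ge) auto
    have "\<rho> * (1 + A) < 1"
      using \<rho>(2) \<open>A \<ge> 0\<close> by (simp add: pos_less_divide_eq)
    with \<rho>(1) have \<rho>A: "\<rho> * A \<le> 1"
      by (simp add: distrib_left)
    have "(u x0 + \<rho> * D u) - (v x0 + \<rho> * D v)
        = (1 - \<rho> * A) * e x0 + \<rho> * (\<Sum>y\<in>N. a y * e y)"
    proof -
      have "D u - D v = (\<Sum>y\<in>N. a y * e y - a y * e x0)"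
        by (simp add: D e_def algebra_simps flip: sum_subtractf)
      also have "\<dots> = (\<Sum>y\<in>N. a y * e y) - A * e x0"
        by (simp add: A_def sum_subtractf sum_distrib_right)
      finally have "\<rho> * (D u - D v) = \<rho> * ((\<Sum>y\<in>N. a y * e y) - A * e x0)"
        by simp
      then show ?thesis
        by (simp add: e_def algebra_simps)
    qed
    also have "\<bar>\<dots>\<bar> \<le> (1 - \<rho> * A) * M + \<rho> * (A * M)"
    proof (rule order_trans[OF abs_triangle_ineq add_mono])
      show "\<bar>(1 - \<rho> * A) * e x0\<bar> \<le> (1 - \<rho> * A) * M"
        using \<rho>A e_le by (simp add: abs_mult mult_left_mono)
      have "\<bar>\<Sum>y\<in>N. a y * e y\<bar> \<le> (\<Sum>y\<in>N. a y * M)"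
        using a e_le by (intro order_trans[OF sum_abs] sum_mono) (auto simp: abs_mult mult_left_mono)
      also have "\<dots> = A * M"
        by (simp add: A_def sum_distrib_right)
      finally show "\<bar>\<rho> * (\<Sum>y\<in>N. a y * e y)\<bar> \<le> \<rho> * (A * M)"
        using \<rho>(1) by (simp add: abs_mult)
    qed
    also have "\<dots> = M"
      by (simp add: algebra_simps)
    finally show ?thesis
      by (simp add: M_def)
  qed
  moreover have "1 / (1 + A) > 0"
    using \<open>A \<ge> 0\<close> by simp
  ultimately show ?thesis
    unfolding stable_scheme_def by blast
qed

text \<open>
  Convex weights of the point solve the linear system defining the coordinates, and that
  system has only one solution.
\<close>

lemma bary_coords_in_convex_hull:
  fixes x0 x :: "real ^ 'n" and p :: "'n \<Rightarrow> real ^ 'n"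
  assumes inv: "invertible (edge_matrix x0 p)" and "inj p"
    and x: "x \<in> convex hull (range p)"
  shows "bary_coords x0 p x $ i \<ge> 0" and "(\<Sum>i\<in>UNIV. bary_coords x0 p x $ i) = 1"
proof -
  from x obtain c where c: "\<forall>y\<in>range p. c y \<ge> 0" "sum c (range p) = 1"
      "(\<Sum>y\<in>range p. c y *\<^sub>R y) = x"
    by (auto simp: convex_hull_finite)
  define l :: "real ^ 'n" where "l = (\<chi> i. c (p i))"
  have sum1: "(\<Sum>i\<in>UNIV. l $ i) = 1"
    using c(2) \<open>inj p\<close> by (simp add: l_def sum.reindex)
  have comb: "(\<Sum>i\<in>UNIV. l $ i *\<^sub>R p i) = x"
    using c(3) \<open>inj p\<close> by (simp add: l_def sum.reindex)
  have "bary_coords x0 p x = l"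
    by (rule bary_coords_eqI[OF inv sum1 comb])
  then show "bary_coords x0 p x $ i \<ge> 0" "(\<Sum>i\<in>UNIV. bary_coords x0 p x $ i) = 1"
    using c(1) sum1 by (simp_all add: l_def)
qed

lemma monotone_scheme_interpolation:
  fixes x0 x :: "real ^ 'n" and p :: "'n \<Rightarrow> real ^ 'n"
  assumes inv: "invertible (edge_matrix x0 p)" and "inj p"
    and x: "x \<in> convex hull (range p)"
  shows "monotone_scheme x0 (range p) (\<lambda>u. lin_interp x0 p u x - u x0)"
proof -
  define l where "l = bary_coords x0 p x"
  note l = bary_coords_in_convex_hull[OF assms, folded l_def]
  have "lin_interp x0 p u x - u x0 = (\<Sum>y\<in>range p. l $ inv p y * (u y - u x0))" for u
  proof -
    have "lin_interp x0 p u x - u x0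
        = (\<Sum>i\<in>UNIV. l $ i * u (p i)) - (\<Sum>i\<in>UNIV. l $ i) * u x0"
      by (simp add: lin_interp_def l_def[symmetric] l(2))
    also have "\<dots> = (\<Sum>i\<in>UNIV. l $ i * (u (p i) - u x0))"
      by (simp add: right_diff_distrib sum_subtractf sum_distrib_right)
    also have "\<dots> = (\<Sum>y\<in>range p. l $ inv p y * (u y - u x0))"
      using \<open>inj p\<close> by (simp add: sum.reindex)
    finally show ?thesis .
  qed
  with l(1) show ?thesis
    unfolding monotone_scheme_iff[OF finite_imageI[OF finite]]
    by (intro exI[of _ "\<lambda>y. l $ inv p y"]) auto
qed

theorem lemma1:
  fixes w x0 :: "real ^ 'n" and p m :: "'n \<Rightarrow> real ^ 'n" and tp tm :: real
  assumes "norm w = 1"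
    and "inj p" and "\<not> affine_dependent (range p)"
    and "inj m" and "\<not> affine_dependent (range m)"
    and "invertible (edge_matrix x0 p)" and "invertible (edge_matrix x0 m)"
    and "tp > 0" and "x0 + tp *\<^sub>R w \<in> convex hull (range p)"
    and "tm > 0" and "x0 - tm *\<^sub>R w \<in> convex hull (range m)"
  shows "monotone_scheme x0 (range p) (D_plus x0 p tp w)
       \<and> stable_scheme x0 (range p) (D_plus x0 p tp w)
       \<and> monotone_scheme x0 (range m) (D_minus x0 m tm w)
       \<and> stable_scheme x0 (range m) (D_minus x0 m tm w)
       \<and> monotone_scheme x0 (range p \<union> range m) (D_second x0 p m tp tm w)
       \<and> stable_scheme x0 (range p \<union> range m) (D_second x0 p m tp tm w)"
proof -
  have plus: "monotone_scheme x0 (range p) (D_plus x0 p tp w)"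
    using monotone_scheme_cmult[OF monotone_scheme_interpolation, of x0 p "x0 + tp *\<^sub>R w" "1 / tp"]
      assms by (simp add: D_plus_def[abs_def])
  have minus: "monotone_scheme x0 (range m) (D_minus x0 m tm w)"
    using monotone_scheme_cmult[OF monotone_scheme_interpolation, of x0 m "x0 - tm *\<^sub>R w" "1 / tm"]
      assms by (simp add: D_minus_def[abs_def])
  have "monotone_scheme x0 (range p \<union> range m)
      (\<lambda>u. 2 / (tp + tm) * (D_plus x0 p tp w u + D_minus x0 m tm w u))"
    using \<open>tp > 0\<close> \<open>tm > 0\<close>
    by (intro monotone_scheme_cmult monotone_scheme_add
        monotone_scheme_superset[OF plus] monotone_scheme_superset[OF minus]) auto
  then have second: "monotone_scheme x0 (range p \<union> range m) (D_second x0 p m tp tm w)"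
    by (simp add: D_second_def[abs_def])
  show ?thesis
    using plus minus second by (simp add: monotone_imp_stable)
qed

end
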